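(* Let $a_{-2},a_{-1},a_1,a_2,c$ be indeterminates. For $n\ge0$ let $T_n(a_{-2},a_{-1},c,a_1,a_2)$ be the $n\times n$ pentadiagonal Toeplitz matrix, and let $$F_n^{(+1)}(c)=\operatorname{perm}T_n(a_{-2},a_{-1},c,a_1,a_2),\qquad F_n^{(-1)}(c)=\det T_n(a_{-2},a_{-1},c,a_1,a_2).$$ Put $p=a_{-1}a_1$, $t=a_{-2}a_2$, $v=a_{-2}a_1^2+a_{-1}^2a_2$, and for $\varepsilon\in\{+1,-1\}$ $$Q_\varepsilon(z)=1-(\varepsilon p+t)z^2-vz^3-t(\varepsilon p+t)z^4+t^3z^6,\qquad Z^{(\varepsilon)}(z)=\sum_{n\ge0}F_n^{(\varepsilon)}(0)z^n.$$ Then for each $\varepsilon\in\{+1,-1\}$, as formal power series in $z$, $$Z^{(\varepsilon)}(z)=\frac{1-tz^2}{Q_\varepsilon(z)},$$ $$\sum_{n\ge0}F_n^{(\varepsilon)}(c)z^n=\frac{Z^{(\varepsilon)}(z)}{1-cz(1+\varepsilon tz^2)Z^{(\varepsilon)}(z)}=\frac{1-tz^2}{Q_\varepsilon(z)-cz(1+\varepsilon tz^2)(1-tz^2)}.$$ Equivalently, $$\sum_{n\ge0}F_n^{(+1)}(c)z^n=\frac{Z^{(+1)}(z)}{1-cz(1+tz^2)Z^{(+1)}(z)}=\frac{1-tz^2}{Q_{+1}(z)-cz(1-t^2z^4)},$$ $$\sum_{n\ge0}F_n^{(-1)}(c)z^n=\frac{Z^{(-1)}(z)}{1-cz(1-tz^2)Z^{(-1)}(z)}=\frac{1-tz^2}{Q_{-1}(z)-cz(1-tz^2)^2}.$$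 Moreover $F_n^{(\varepsilon)}(c)\in\mathbb Z[c,p,t,v]$ for all $n\ge0$ and $\varepsilon=\pm1$.
   Context: $T_n(a_{-2},a_{-1},c,a_1,a_2)$ is the $n\times n$ matrix whose $(i,j)$ entry is $a_{j-i}$ if $0<|j-i|\le2$, $c$ if $i=j$, and $0$ otherwise. $\operatorname{perm}$ denotes the permanent; the determinant and permanent of the empty ($n=0$) matrix are $1$. *)

theory Defs
  imports
    "HOL-Library.Poly_Mapping"
    "HOL-Computational_Algebra.Formal_Power_Series"
    "Jordan_Normal_Form.Determinant"
begin

datatype indet = A_m2 | A_m1 | A_1 | A_2 | C

text \<open>The polynomial ring over the integers in the five indeterminates: finitely supported
  functions from exponent vectors to integer coefficients, with convolution as product.\<close>

type_synonym zpoly = "(indet \<Rightarrow>\<^sub>0 nat) \<Rightarrow>\<^sub>0 int"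

definition Var :: "indet \<Rightarrow> zpoly"
  where "Var x = Poly_Mapping.single (Poly_Mapping.single x 1) 1"

definition permanent :: "'a mat \<Rightarrow> 'a :: comm_ring_1"
  where "permanent M = (if dim_row M = dim_col M
    then (\<Sum>\<pi> \<in> {\<pi>. \<pi> permutes {0..<dim_row M}}. \<Prod>i = 0..<dim_row M. M $$ (i, \<pi> i))
    else 0)"

definition penta_toeplitz ::
    "nat \<Rightarrow> 'a \<Rightarrow> 'a \<Rightarrow> 'a \<Rightarrow> 'a \<Rightarrow> 'a \<Rightarrow> 'a :: comm_ring_1 mat"
  where "penta_toeplitz n am2 am1 c a1 a2 = mat n n (\<lambda>(i, j).
    let d = int j - int i in
      if d = - 2 then am2
      else if d = - 1 then am1
      else if d = 0 then c
      else if d = 1 then a1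
      else if d = 2 then a2
      else 0)"

text \<open>The sign \<open>e\<close> only takes the values \<open>1\<close> (permanent) and \<open>- 1\<close> (determinant).\<close>

definition signed_imm :: "int \<Rightarrow> 'a mat \<Rightarrow> 'a :: comm_ring_1"
  where "signed_imm e M = (if e = 1 then permanent M else det M)"

definition Q_series :: "int \<Rightarrow> 'a \<Rightarrow> 'a \<Rightarrow> 'a \<Rightarrow> 'a :: comm_ring_1 fps"
  where "Q_series e p t v =
    1 - fps_const (of_int e * p + t) * fps_X ^ 2
      - fps_const v * fps_X ^ 3
      - fps_const (t * (of_int e * p + t)) * fps_X ^ 4
      + fps_const (t ^ 3) * fps_X ^ 6"

text \<open>Quotient of power series over a commutative ring by a series with constant coefficient 1
  (library division needs inverses in the coefficient ring). It is meaningful only for such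
  denominators; the two lemmas show that it is then the unique solution \<open>h\<close> of \<open>h * g = f\<close>.\<close>

definition fps_quot :: "'a fps \<Rightarrow> 'a fps \<Rightarrow> 'a :: comm_ring_1 fps"  (infixl \<open>\<oslash>\<close> 70)
  where "f \<oslash> g = f * fps_right_inverse g 1"

lemma fps_quot_mult:
  fixes f g :: "'a :: comm_ring_1 fps"
  assumes "fps_nth g 0 = 1"
  shows "(f \<oslash> g) * g = f"
proof -
  have "g * fps_right_inverse g 1 = 1"
    by (rule fps_right_inverse) (simp add: assms)
  then show ?thesis
    unfolding fps_quot_def by (metis mult.assoc mult.commute mult_1_right)
qed

lemma fps_quot_unique:
  fixes f g h :: "'a :: comm_ring_1 fps"
  assumes "fps_nth g 0 = 1" "h * g = f"
  shows "h = f \<oslash> g"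
proof -
  have "g * fps_right_inverse g 1 = 1"
    by (rule fps_right_inverse) (simp add: assms(1))
  then show ?thesis
    by (simp add: fps_quot_def assms(2)[symmetric] mult.assoc)
qed

text \<open>The subring \<open>\<int>[S]\<close> generated by a set \<open>S\<close> of ring elements.\<close>

inductive_set int_adjoin :: "'a :: comm_ring_1 set \<Rightarrow> 'a set" for S
  where
    gen: "x \<in> S \<Longrightarrow> x \<in> int_adjoin S"
  | one: "1 \<in> int_adjoin S"
  | diff: "x \<in> int_adjoin S \<Longrightarrow> y \<in> int_adjoin S \<Longrightarrow> x - y \<in> int_adjoin S"
  | mult: "x \<in> int_adjoin S \<Longrightarrow> y \<in> int_adjoin S \<Longrightarrow> x * y \<in> int_adjoin S"

end

theory Submission
  imports Defs
begin

text \<open>Expanding a permanent or determinant of a pentadiagonal Toeplitz matrix along successive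
  first rows, all columns more than two steps behind must have been used, and at most two columns
  ahead can have been used; hence exactly two columns of a window of four are free, and the
  expansion is a walk on six states. The generating functions of the six states satisfy a linear
  system; three of them reduce at once to the others, and eliminating the rest gives the
  denominator \<open>Q - c z (1 + \<epsilon> t z\<^sup>2) (1 - t z\<^sup>2)\<close> with numerator \<open>1 - t z\<^sup>2\<close>. Setting \<open>c = 0\<close> gives
  \<open>Z\<close>, and since the denominator has constant coefficient \<open>1\<close> and all coefficients in
  \<open>\<int>[c, p, t, v]\<close>, so has the quotient.\<close>

section \<open>Expansion of permanents and determinants along the first row\<close>

text \<open>The permutations are grouped by the image \<open>j\<close> of row 0; each group consists
  of the insertions of \<open>j\<close> into permutations of size \<open>n\<close>.\<close>

lemma permanent_expand_first_row:
  fixes A :: "'a :: comm_ring_1 mat"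
  assumes A: "A \<in> carrier_mat (Suc n) (Suc n)"
  shows "permanent A = (\<Sum>j<Suc n. A $$ (0, j) * permanent (mat_delete A 0 j))"
proof -
  let ?P = "{\<pi>. \<pi> permutes {0..<Suc n}}"
  let ?f = "\<lambda>\<pi>. \<Prod>i = 0..<Suc n. A $$ (i, \<pi> i)"
  have fin: "finite ?P" by (simp add: finite_permutations)
  have img: "(\<lambda>\<pi>. \<pi> 0) ` ?P \<subseteq> {..<Suc n}"
    using permutes_in_image by fastforce
  have "permanent A = sum ?f ?P"
    using A by (simp add: permanent_def)
  also have "\<dots> = (\<Sum>j<Suc n. sum ?f {\<pi> \<in> ?P. \<pi> 0 = j})"
    using sum.group[OF fin _ img, of ?f] by simp
  also have "\<dots> = (\<Sum>j<Suc n. A $$ (0, j) * permanent (mat_delete A 0 j))"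
  proof (rule sum.cong[OF refl])
    fix j assume "j \<in> {..<Suc n}"
    then have j: "j < Suc n" by simp
    have fac: "?f (permutation_insert 0 j q) = A $$ (0, j) * (\<Prod>i = 0..<n. mat_delete A 0 j $$ (i, q i))"
      if q: "q permutes {0..<n}" for q
    proof -
      \<comment> \<open>\<open>permutation_insert\<close> and \<open>mat_delete\<close> skip column
        \<open>j\<close> in the same way.\<close>
      have "A $$ (Suc i, permutation_insert 0 j q (Suc i)) = mat_delete A 0 j $$ (i, q i)"
        if "i < n" for i
      proof -
        have "q i < n" using that permutes_in_image[OF q, of i] by simp
        then show ?thesis
          using A that by (simp add: mat_delete_def permutation_insert_expand)
      qed
      then show ?thesis
        by (simp add: prod.atLeast0_lessThan_Suc_shift del: prod.op_ivl_Suc)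
    qed
    have "{\<pi> \<in> ?P. \<pi> 0 = j} = permutation_insert 0 j ` {q. q permutes {0..<n}}"
      using permutation_fix[of 0 n j] j by simp
    then have "sum ?f {\<pi> \<in> ?P. \<pi> 0 = j} = (\<Sum>q | q permutes {0..<n}. ?f (permutation_insert 0 j q))"
      using sum.reindex[OF permutation_insert_inj_on[of 0 n j], of ?f] j by simp
    also have "\<dots> = A $$ (0, j) * permanent (mat_delete A 0 j)"
      using A fac by (simp add: permanent_def sum_distrib_left)
    finally show "sum ?f {\<pi> \<in> ?P. \<pi> 0 = j} = A $$ (0, j) * permanent (mat_delete A 0 j)" .
  qed
  finally show ?thesis .
qed

text \<open>The factor \<open>of_int e ^ j\<close> is the cofactor sign for \<open>e = - 1\<close>
  and trivial for \<open>e = 1\<close>, so both cases can be treated together from here on.\<close>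

lemma signed_imm_expand_first_row:
  fixes A :: "'a :: comm_ring_1 mat"
  assumes A: "A \<in> carrier_mat (Suc n) (Suc n)" and e: "e \<in> {1, - 1}"
  shows "signed_imm e A = (\<Sum>j<Suc n. of_int e ^ j * A $$ (0, j) * signed_imm e (mat_delete A 0 j))"
proof (cases "e = 1")
  case True
  then show ?thesis
    using permanent_expand_first_row[OF A] by (simp add: signed_imm_def)
next
  case False
  then have e: "e = - 1" using e by simp
  have "A $$ (0, j) * cofactor A 0 j = (- 1) ^ j * A $$ (0, j) * det (mat_delete A 0 j)" for j
    by (simp add: cofactor_def ac_simps)
  then show ?thesis
    using laplace_expansion_row[OF A, of 0] by (simp add: signed_imm_def e)
qed

lemma signed_imm_0:
  assumes "A \<in> carrier_mat 0 0"
  shows "signed_imm e A = 1"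
  using assms by (simp add: signed_imm_def permanent_def det_def)

section \<open>Window matrices and the walk on column states\<close>

text \<open>After the first rows and as many columns have been removed by expansion, the remaining
  matrix has the columns numbered \<open>r\<close>, \<open>s\<close>, \<open>2\<close>, \<open>3\<close>, and so on, relative to its first row
  (number \<open>0\<close>). A negative \<open>r\<close> or \<open>s\<close> is a column of the original band not yet used.\<close>

definition window_mat :: "(int \<Rightarrow> 'a) \<Rightarrow> int \<Rightarrow> int \<Rightarrow> nat \<Rightarrow> 'a mat"
  where "window_mat a r s n = mat n n (\<lambda>(i, j).
    a ((if j = 0 then r else if j = 1 then s else int j) - int i))"

lemma window_mat_carrier [simp]: "window_mat a r s n \<in> carrier_mat n n"
  by (simp add: window_mat_def)

text \<open>Passing to the next row lowers all column numbers by one, so column 2 becomes the new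
  \<open>1\<close> unless it is the one removed.\<close>

lemma window_mat_delete:
  "mat_delete (window_mat a r s (Suc n)) 0 0 = window_mat a (s - 1) 1 n"
  "mat_delete (window_mat a r s (Suc n)) 0 (Suc 0) = window_mat a (r - 1) 1 n"
  "mat_delete (window_mat a r s (Suc n)) 0 2 = window_mat a (r - 1) (s - 1) n"
  by (auto simp: window_mat_def mat_delete_def intro!: eq_matI arg_cong[where f = a])

lemma signed_imm_window_mat_1:
  fixes a :: "int \<Rightarrow> 'a :: comm_ring_1"
  assumes "e \<in> {1, - 1}"
  shows "signed_imm e (window_mat a r s (Suc 0)) = a r"
  using signed_imm_expand_first_row[OF window_mat_carrier assms, of a r s 0]
  by (simp add: window_mat_delete signed_imm_0) (simp add: window_mat_def)

text \<open>The end state \<open>r = 0\<close>, \<open>s = 1\<close> is the only one in which no column to the right of the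
  matrix has been used. For \<open>n \<le> 1\<close> the truncated matrix \<open>window_mat a r s n\<close> hides a pending
  column, so it agrees with \<open>walk\<close> in all states only from size 2 on.\<close>

primrec walk :: "int \<Rightarrow> (int \<Rightarrow> 'a) \<Rightarrow> nat \<Rightarrow> int \<Rightarrow> int \<Rightarrow> 'a :: comm_ring_1"
  where
    "walk e a 0 r s = (if r = 0 \<and> s = 1 then 1 else 0)"
  | "walk e a (Suc n) r s = a r * walk e a n (s - 1) 1
       + of_int e * a s * walk e a n (r - 1) 1 + a 2 * walk e a n (r - 1) (s - 1)"

text \<open>The bounds \<open>r < s\<close> and \<open>s \<le> 1\<close> pass to all three successor
  states; at size 2 they leave only the two paths that use both pending columns.\<close>

lemma signed_imm_window_mat:
  fixes a :: "int \<Rightarrow> 'a :: comm_ring_1"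
  assumes e: "e \<in> {1, - 1}" and a: "\<And>d. d > 2 \<Longrightarrow> a d = 0" and "r < s" "s \<le> 1"
  shows "signed_imm e (window_mat a r s (Suc (Suc n))) = walk e a (Suc (Suc n)) r s"
  using assms(3,4)
proof (induction n arbitrary: r s)
  case 0
  have "signed_imm e (window_mat a r s (Suc (Suc 0))) = a r * a (s - 1) + of_int e * a s * a (r - 1)"
    using signed_imm_expand_first_row[OF window_mat_carrier e, of a r s "Suc 0"]
    by (simp add: window_mat_delete signed_imm_window_mat_1[OF e]) (simp add: window_mat_def)
  then show ?case
    using 0 by simp
next
  case (Suc n)
  let ?W = "window_mat a r s (Suc (Suc (Suc n)))"
  let ?t = "\<lambda>j. of_int e ^ j * ?W $$ (0, j) * signed_imm e (mat_delete ?W 0 j)"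
  have "signed_imm e ?W = (\<Sum>j<Suc (Suc (Suc n)). ?t j)"
    by (rule signed_imm_expand_first_row[OF window_mat_carrier e])
  also have "\<dots> = (\<Sum>j\<in>{0, 1, 2}. ?t j)"
    by (rule sum.mono_neutral_right) (auto simp: window_mat_def a)
  also have "\<dots> = a r * walk e a (Suc (Suc n)) (s - 1) 1
       + of_int e * a s * walk e a (Suc (Suc n)) (r - 1) 1
       + of_int e ^ 2 * a 2 * walk e a (Suc (Suc n)) (r - 1) (s - 1)"
    using Suc.prems
    by (simp add: window_mat_delete Suc.IH del: walk.simps) (simp add: window_mat_def del: walk.simps)
  \<comment> \<open>Choosing column 2 jumps over both pending columns and costs the sign twice;
    hence \<open>walk\<close> has no sign at \<open>a 2\<close>.\<close>
  also have "of_int e ^ 2 = (1 :: 'a)"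
    using e by auto
  finally show ?case by simp
qed

definition band :: "'a \<Rightarrow> 'a \<Rightarrow> 'a \<Rightarrow> 'a \<Rightarrow> 'a \<Rightarrow> int \<Rightarrow> 'a :: comm_ring_1"
  where "band am2 am1 c a1 a2 d =
    (if d = - 2 then am2 else if d = - 1 then am1 else if d = 0 then c
     else if d = 1 then a1 else if d = 2 then a2 else 0)"

lemma penta_toeplitz_conv_window_mat:
  "penta_toeplitz n am2 am1 c a1 a2 = window_mat (band am2 am1 c a1 a2) 0 1 n"
  by (auto simp: penta_toeplitz_def window_mat_def band_def Let_def intro!: eq_matI)

lemma signed_imm_penta_toeplitz:
  assumes e: "e \<in> {1, - 1}"
  shows "signed_imm e (penta_toeplitz n am2 am1 c a1 a2) = walk e (band am2 am1 c a1 a2) n 0 1"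
proof -
  let ?a = "band am2 am1 c a1 a2"
  consider "n = 0" | "n = Suc 0" | m where "n = Suc (Suc m)"
    by (metis not0_implies_Suc)
  then show ?thesis
  proof cases
    case 1
    then show ?thesis by (simp add: penta_toeplitz_conv_window_mat signed_imm_0)
  next
    case 2
    then show ?thesis by (simp add: penta_toeplitz_conv_window_mat signed_imm_window_mat_1[OF e])
  next
    case 3
    then show ?thesis
      using signed_imm_window_mat[OF e, of ?a 0 1 m]
      by (simp add: penta_toeplitz_conv_window_mat band_def del: walk.simps)
  qed
qed

section \<open>Generating functions of the states\<close>

definition walk_gf :: "int \<Rightarrow> (int \<Rightarrow> 'a) \<Rightarrow> int \<Rightarrow> int \<Rightarrow> 'a :: comm_ring_1 fps"
  where "walk_gf e a r s = Abs_fps (\<lambda>n. walk e a n r s)"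

lemma walk_gf_step:
  "walk_gf e a r s = (if r = 0 \<and> s = 1 then 1 else 0) + fps_X *
    (fps_const (a r) * walk_gf e a (s - 1) 1
     + of_int e * fps_const (a s) * walk_gf e a (r - 1) 1
     + fps_const (a 2) * walk_gf e a (r - 1) (s - 1))"
proof (rule fps_ext)
  fix n
  show "fps_nth (walk_gf e a r s) n = fps_nth ((if r = 0 \<and> s = 1 then 1 else 0) + fps_X *
    (fps_const (a r) * walk_gf e a (s - 1) 1
     + of_int e * fps_const (a s) * walk_gf e a (r - 1) 1
     + fps_const (a 2) * walk_gf e a (r - 1) (s - 1))) n"
    by (cases n) (simp_all add: walk_gf_def fps_of_int[symmetric] mult.assoc del: fps_of_int)
qed

text \<open>A column more than two steps behind is out of reach of every later row, so it stays
  pending and the end state is never attained.\<close>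

lemma walk_gf_eq_0:
  assumes a: "\<And>d. d < - 2 \<Longrightarrow> a d = 0" and "r < - 2"
  shows "walk_gf e a r s = 0"
proof -
  have "walk e a n r s = 0" for n
    using assms(2) by (induction n arbitrary: r s) (simp_all add: a)
  then show ?thesis by (simp add: walk_gf_def fps_zero_def)
qed

lemma Q_series_eq:
  "Q_series e p t v = 1 - (of_int e * fps_const p + fps_const t) * fps_X ^ 2
     - fps_const v * fps_X ^ 3
     - fps_const t * (of_int e * fps_const p + fps_const t) * fps_X ^ 4
     + fps_const t ^ 3 * fps_X ^ 6"
  by (simp add: Q_series_def fps_of_int[symmetric] fps_const_power[symmetric]
      fps_const_mult[symmetric] fps_const_add[symmetric]
      del: fps_of_int fps_const_power fps_const_mult fps_const_add)

text \<open>The product form avoids division, and \<open>c\<close> is arbitrary so that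
  \<open>c = 0\<close> gives the equation for \<open>Z\<close>.\<close>

lemma penta_toeplitz_gf:
  fixes am2 am1 c a1 a2 :: "'a :: comm_ring_1" and e :: int
  defines "p \<equiv> am1 * a1" and "t \<equiv> am2 * a2" and "v \<equiv> am2 * a1 ^ 2 + am1 ^ 2 * a2"
  assumes e: "e \<in> {1, - 1}"
  shows "Abs_fps (\<lambda>n. signed_imm e (penta_toeplitz n am2 am1 c a1 a2)) *
    (Q_series e p t v - fps_const c * fps_X *
      (1 + of_int e * fps_const t * fps_X ^ 2) * (1 - fps_const t * fps_X ^ 2)) =
    1 - fps_const t * fps_X ^ 2"
proof -
  define a where "a = band am2 am1 c a1 a2"
  define z :: "'a fps" where "z = fps_X"
  \<comment> \<open>\<open>E\<close> stays symbolic with \<open>E * E = 1\<close>, so one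
    elimination serves both signs.\<close>
  define E :: "'a fps" where "E = of_int e"
  define b2 b1 d1 d2 k where
    K: "b2 = fps_const am2" "b1 = fps_const am1" "d1 = fps_const a1" "d2 = fps_const a2"
      "k = fps_const c"
  let ?g = "walk_gf e a"
  have E: "E * E = 1" using e by (auto simp: E_def)
  have a_simps: "a (- 2) = am2" "a (- 1) = am1" "a 0 = c" "a 1 = a1" "a 2 = a2"
    by (simp_all add: a_def band_def)
  have zero: "?g (- 3) s = 0" for s
    by (rule walk_gf_eq_0) (simp_all add: a_def band_def)
  define A B where "A = ?g 0 1" and "B = ?g (- 1) 1"
  note step = walk_gf_step[of e a, folded z_def E_def]
  \<comment> \<open>With \<open>r = - 2\<close> the first column must be used now, or it would move
    to \<open>- 3\<close>; one term survives.\<close>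
  have D: "?g (- 2) 1 = z * (b2 * A)" 
    using step[of "- 2" 1] by (simp add: a_simps zero K A_def)
  have F: "?g (- 2) 0 = z * (b2 * B)" 
    using step[of "- 2" 0] by (simp add: a_simps zero K B_def)
  have G: "?g (- 2) (- 1) = z * (b2 * (z * (b2 * A)))" 
    using step[of "- 2" "- 1"] by (simp add: a_simps zero K D)
  have H: "?g (- 1) 0 = z * (b1 * B + E * k * (z * (b2 * A)) + d2 * (z * (b2 * (z * (b2 * A)))))"
    using step[of "- 1" 0] by (simp add: a_simps K D G B_def)
  have B: "B = z * (b1 * A + E * d1 * (z * (b2 * A)) + d2 * (z * (b2 * B)))"
    using step[of "- 1" 1] by (simp add: a_simps K D F B_def[symmetric] A_def[symmetric])
  have A: "A = 1 + z * (k * A + E * d1 * B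
      + d2 * (z * (b1 * B + E * k * (z * (b2 * A)) + d2 * (z * (b2 * (z * (b2 * A)))))))"
    using step[of 0 1] by (simp add: a_simps K H B_def[symmetric] A_def[symmetric])
  have Q: "Q_series e p t v = 1 - (E * (b1 * d1) + b2 * d2) * z ^ 2
      - (b2 * d1 ^ 2 + b1 ^ 2 * d2) * z ^ 3
      - b2 * d2 * (E * (b1 * d1) + b2 * d2) * z ^ 4 + (b2 * d2) ^ 3 * z ^ 6"
    by (simp add: Q_series_eq p_def t_def v_def K E_def z_def fps_const_power[symmetric]
        fps_const_mult[symmetric] fps_const_add[symmetric]
        del: fps_const_power fps_const_mult fps_const_add)
  have T: "fps_const t = b2 * d2" by (simp add: t_def K)
  have "A * (Q_series e p t v - k * z * (1 + E * (b2 * d2) * z ^ 2) * (1 - b2 * d2 * z ^ 2))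
     = 1 - b2 * d2 * z ^ 2"
  proof -
    \<comment> \<open>Eliminates \<open>B\<close>: equation \<open>A\<close> is multiplied by \<open>1 - t z\<^sup>2\<close>, the coefficient that \<open>B\<close>
      has in its own equation.\<close>
    have "A * (Q_series e p t v - k * z * (1 + E * (b2 * d2) * z ^ 2) * (1 - b2 * d2 * z ^ 2))
        - (1 - b2 * d2 * z ^ 2)
      = (1 - b2 * d2 * z ^ 2) * (A - (1 + z * (k * A + E * d1 * B
          + d2 * (z * (b1 * B + E * k * (z * (b2 * A)) + d2 * (z * (b2 * (z * (b2 * A)))))))))
        + z * (E * d1 + d2 * z * b1)
            * (B - z * (b1 * A + E * d1 * (z * (b2 * A)) + d2 * (z * (b2 * B))))
        + (E * E - 1) * (z ^ 3 * d1 ^ 2 * b2 * A)"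
      unfolding Q by (simp add: algebra_simps eval_nat_numeral)
    then show ?thesis
      by (simp add: A[symmetric] B[symmetric] E)
  qed
  moreover have "Abs_fps (\<lambda>n. signed_imm e (penta_toeplitz n am2 am1 c a1 a2)) = A"
    by (simp add: A_def walk_gf_def a_def signed_imm_penta_toeplitz[OF e])
  ultimately show ?thesis by (simp add: T E_def z_def K)
qed

section \<open>Power series over a generated subring\<close>

lemma int_adjoin_0: "0 \<in> int_adjoin S"
  using int_adjoin.diff[OF int_adjoin.one int_adjoin.one] by simp

lemma int_adjoin_uminus: "x \<in> int_adjoin S \<Longrightarrow> - x \<in> int_adjoin S"
  using int_adjoin.diff[OF int_adjoin_0] by force

lemma int_adjoin_add: "x \<in> int_adjoin S \<Longrightarrow> y \<in> int_adjoin S \<Longrightarrow> x + y \<in> int_adjoin S"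
  using int_adjoin.diff[OF _ int_adjoin_uminus] by force

lemma int_adjoin_sum: "(\<And>i. i \<in> I \<Longrightarrow> f i \<in> int_adjoin S) \<Longrightarrow> sum f I \<in> int_adjoin S"
  by (induction I rule: infinite_finite_induct) (auto simp: int_adjoin_0 int_adjoin_add)

definition fps_over :: "'a set \<Rightarrow> 'a :: zero fps set"
  where "fps_over R = {f. \<forall>n. fps_nth f n \<in> R}"

lemma fps_over_int_adjoin:
  fixes S :: "'a :: comm_ring_1 set"
  defines "R \<equiv> fps_over (int_adjoin S)"
  shows "1 \<in> R" "fps_X \<in> R" "x \<in> S \<Longrightarrow> fps_const x \<in> R"
    "f \<in> R \<Longrightarrow> g \<in> R \<Longrightarrow> f + g \<in> R" "f \<in> R \<Longrightarrow> g \<in> R \<Longrightarrow> f - g \<in> R"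
    "f \<in> R \<Longrightarrow> g \<in> R \<Longrightarrow> f * g \<in> R"
  unfolding R_def fps_over_def
  by (auto simp: fps_X_def fps_mult_nth int_adjoin_0
      intro!: int_adjoin.one int_adjoin.diff int_adjoin.mult int_adjoin_add int_adjoin_sum
      intro: int_adjoin.gen)

lemma fps_over_power:
  fixes S :: "'a :: comm_ring_1 set"
  assumes "f \<in> fps_over (int_adjoin S)"
  shows "f ^ n \<in> fps_over (int_adjoin S)"
  using assms by (induction n) (auto intro: fps_over_int_adjoin)

text \<open>As \<open>g\<close> has constant coefficient 1, each coefficient of \<open>h\<close> is
  determined without division by \<open>f\<close>, \<open>g\<close> and the earlier coefficients of
  \<open>h\<close>.\<close>

lemma fps_over_quotient:
  fixes f g h :: "'a :: comm_ring_1 fps"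
  assumes g0: "fps_nth g 0 = 1" and eq: "h * g = f"
    and f: "f \<in> fps_over (int_adjoin S)" and g: "g \<in> fps_over (int_adjoin S)"
  shows "h \<in> fps_over (int_adjoin S)"
proof -
  have "fps_nth h n \<in> int_adjoin S" for n
  proof (induction n rule: less_induct)
    case (less n)
    have "fps_nth f n = (\<Sum>i = 0..n. fps_nth h i * fps_nth g (n - i))"
      unfolding eq[symmetric] by (rule fps_mult_nth)
    also have "\<dots> = fps_nth h n + (\<Sum>i = 0..<n. fps_nth h i * fps_nth g (n - i))"
      by (simp add: sum.last_plus g0)
    finally have "fps_nth h n = fps_nth f n - (\<Sum>i = 0..<n. fps_nth h i * fps_nth g (n - i))"
      by simp
    then show ?case
      using f g less by (auto simp: fps_over_def intro!: int_adjoin.diff int_adjoin.mult int_adjoin_sum)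
  qed
  then show ?thesis by (simp add: fps_over_def)
qed

section \<open>Quotient formulas and integrality\<close>

theorem proposition4p5:
  fixes am2 am1 a1 a2 c p t v :: zpoly
    and z :: "zpoly fps"
    and F :: "int \<Rightarrow> nat \<Rightarrow> zpoly \<Rightarrow> zpoly"
    and Q Z :: "int \<Rightarrow> zpoly fps"
    and K :: "zpoly \<Rightarrow> zpoly fps"
  defines "am2 \<equiv> Var A_m2" and "am1 \<equiv> Var A_m1" and "a1 \<equiv> Var A_1" and "a2 \<equiv> Var A_2"
    and "c \<equiv> Var C"
    and "p \<equiv> am1 * a1" and "t \<equiv> am2 * a2" and "v \<equiv> am2 * a1 ^ 2 + am1 ^ 2 * a2"
    and "z \<equiv> fps_X" and "K \<equiv> fps_const"
    and "F \<equiv> (\<lambda>e n x. signed_imm e (penta_toeplitz n am2 am1 x a1 a2))"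
    and "Q \<equiv> (\<lambda>e. Q_series e p t v)"
    and "Z \<equiv> (\<lambda>e. Abs_fps (\<lambda>n. F e n 0))"
  shows
    "(\<forall>e \<in> {1, - 1}.
        Z e = (1 - K t * z ^ 2) \<oslash> Q e \<and>
        Abs_fps (\<lambda>n. F e n c) = Z e \<oslash> (1 - K c * z * (1 + of_int e * K t * z ^ 2) * Z e) \<and>
        Abs_fps (\<lambda>n. F e n c) = (1 - K t * z ^ 2) \<oslash>
          (Q e - K c * z * (1 + of_int e * K t * z ^ 2) * (1 - K t * z ^ 2))) \<and>
     Abs_fps (\<lambda>n. F 1 n c) = Z 1 \<oslash> (1 - K c * z * (1 + K t * z ^ 2) * Z 1) \<and>
     Abs_fps (\<lambda>n. F 1 n c) = (1 - K t * z ^ 2) \<oslash> (Q 1 - K c * z * (1 - K (t ^ 2) * z ^ 4)) \<and>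
     Abs_fps (\<lambda>n. F (- 1) n c) = Z (- 1) \<oslash> (1 - K c * z * (1 - K t * z ^ 2) * Z (- 1)) \<and>
     Abs_fps (\<lambda>n. F (- 1) n c) =
       (1 - K t * z ^ 2) \<oslash> (Q (- 1) - K c * z * (1 - K t * z ^ 2) ^ 2) \<and>
     (\<forall>e \<in> {1, - 1}. \<forall>n. F e n c \<in> int_adjoin {c, p, t, v})"
proof -
  define H where "H = (\<lambda>e. Abs_fps (\<lambda>n. F e n c))"
  define N where "N = 1 - K t * z ^ 2"
  define U where "U = (\<lambda>e. K c * z * (1 + of_int e * K t * z ^ 2))"
  have H_eq: "H e * (Q e - U e * N) = N" and Z_eq: "Z e * Q e = N" if "e \<in> {1, - 1}" for e
    using penta_toeplitz_gf[OF that, of am2 am1 c a1 a2] penta_toeplitz_gf[OF that, of am2 am1 0 a1 a2]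
    by (simp_all add: H_def Z_def F_def Q_def U_def N_def K_def z_def p_def t_def v_def)
  have Q0: "fps_nth (Q e) 0 = 1" and U0: "fps_nth (U e) 0 = 0" for e
    by (simp_all add: Q_def Q_series_def U_def z_def mult.assoc)
  have Z_quot: "Z e = N \<oslash> Q e" if "e \<in> {1, - 1}" for e
    by (rule fps_quot_unique[OF Q0 Z_eq[OF that]])
  have H_quot: "H e = N \<oslash> (Q e - U e * N)" if "e \<in> {1, - 1}" for e
    by (rule fps_quot_unique[OF _ H_eq[OF that]]) (simp add: Q0 U0)
  have H_quot_Z: "H e = Z e \<oslash> (1 - U e * Z e)" if e: "e \<in> {1, - 1}" for e
  proof (rule fps_quot_unique)
    \<comment> \<open>Multiplication by \<open>Q e\<close> and \<open>Z e * Q e = N\<close> reduce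
      the claim to \<open>H_eq\<close>; uniqueness of the quotient by \<open>Q e\<close> then
      removes the factor.\<close>
    have "H e * (1 - U e * Z e) * Q e = H e * (Q e - U e * (Z e * Q e))"
      by (simp add: algebra_simps)
    then have "H e * (1 - U e * Z e) * Q e = N"
      by (simp add: Z_eq[OF e] H_eq[OF e])
    then show "H e * (1 - U e * Z e) = Z e"
      using fps_quot_unique[OF Q0] Z_quot[OF e] by metis
  qed (simp add: U0)
  have mem: "F e n c \<in> int_adjoin {c, p, t, v}" if e: "e \<in> {1, - 1}" for e n
  proof -
    let ?R = "fps_over (int_adjoin {c, p, t, v})"
    note R = fps_over_int_adjoin[where S = "{c, p, t, v}"] fps_over_power[where S = "{c, p, t, v}"]
    have K: "K c \<in> ?R" "K p \<in> ?R" "K t \<in> ?R" "K v \<in> ?R"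
      by (simp_all add: K_def R)
    have z: "z \<in> ?R" by (simp add: z_def R)
    have "- 1 \<in> ?R" using R(5)[OF R(5)[OF R(1) R(1)] R(1)] by simp
    then have e': "of_int e \<in> ?R" using e R(1) by auto
    have Q: "Q e = 1 - (of_int e * K p + K t) * z ^ 2 - K v * z ^ 3
        - K t * (of_int e * K p + K t) * z ^ 4 + K t ^ 3 * z ^ 6"
      by (simp add: Q_def Q_series_eq K_def z_def)
    have N: "N \<in> ?R" unfolding N_def by (intro R K z)
    have D: "Q e - U e * N \<in> ?R" unfolding Q U_def by (intro R K z N e')
    have "fps_nth (Q e - U e * N) 0 = 1" by (simp add: Q0 U0)
    from fps_over_quotient[OF this H_eq[OF e] N D] show ?thesis
      by (simp add: fps_over_def H_def)
  qed
  have F_gf: "Abs_fps (\<lambda>n. F e n c) = H e"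
    and U_fold: "K c * z * (1 + of_int e * K t * z ^ 2) = U e" for e
    by (simp_all add: H_def U_def)
  have U_1: "K c * z * (1 + K t * z ^ 2) = U 1" and U_m1: "K c * z * N = U (- 1)"
    by (simp_all add: U_def N_def)
  \<comment> \<open>The product is a difference of squares for \<open>e = 1\<close>; for
    \<open>e = - 1\<close> both factors equal \<open>N\<close>.\<close>
  have UN_1: "K c * z * (1 - K (t ^ 2) * z ^ 4) = U 1 * N"
    by (simp add: U_1[symmetric] N_def K_def fps_const_power[symmetric] algebra_simps
       power2_eq_square power4_eq_xxxx del: fps_const_power)
  have UN_m1: "K c * z * N ^ 2 = U (- 1) * N"
    by (simp add: U_m1[symmetric] power2_eq_square mult.assoc)
  show ?thesis
    unfolding F_gf U_fold N_def[symmetric] U_1 U_m1 UN_1 UN_m1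
    using Z_quot H_quot H_quot_Z mem by blast
qed

end
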